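(* $z_4\ge 3/5$.
   Context: Given an edge-coloring $c$ (an arbitrary assignment of colors to edges) of the complete graph $K_n$, let $z(n,c,s)$ be the fraction of the $n$ vertices that are incident with at least one edge of color $s$, and let $z(n,c)$ be the maximum of $z(n,c,s)$ over all colors $s$ appearing in $c$. Let $z_k(n)$ be the minimum of $z(n,c)$ over all edge-colorings $c$ of $K_n$ that use at most $k$ colors, and let $z_k=\inf_{n\ge 2} z_k(n)$. *)

theory Defs
  imports Complex_Main "HOL-Library.Ramsey"
begin

(* The vertices of the complete graph on n vertices are the numbers below n; its edges are the
   two-element sets of vertices. *)
abbreviation K_edges :: "nat \<Rightarrow> nat set set" where
  "K_edges n \<equiv> [{..<n}]\<^bsup>2\<^esup>"

(* A coloring is a total function on sets of which only the values on edges matter. Since a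
   coloring has finitely many edges to color, natural numbers suffice as a palette. *)
type_synonym coloring = "nat set \<Rightarrow> nat"

definition colors :: "nat \<Rightarrow> coloring \<Rightarrow> nat set" where
  "colors n c = c ` K_edges n"

definition z_color :: "nat \<Rightarrow> coloring \<Rightarrow> nat \<Rightarrow> real" where
  "z_color n c s = real (card {v \<in> {..<n}. \<exists>e \<in> K_edges n. v \<in> e \<and> c e = s}) / real n"

definition z_coloring :: "nat \<Rightarrow> coloring \<Rightarrow> real" where
  "z_coloring n c = Max {z_color n c s |s. s \<in> colors n c}"

definition z_min :: "nat \<Rightarrow> nat \<Rightarrow> real" where
  "z_min k n = Min {z_coloring n c |c. card (colors n c) \<le> k}"

definition z_inf :: "nat \<Rightarrow> real" where
  "z_inf k = (INF n\<in>{2..}. z_min k n)"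

(* The following facts show that the extrema above are taken over finite (or bounded below)
   nonempty sets, so that Max, Min and INF have their usual meaning. *)

lemma finite_colors: "finite (colors n c)"
  by (simp add: colors_def finite_imp_finite_nsets)

lemma colors_nonempty:
  assumes "n \<ge> 2" shows "colors n c \<noteq> {}"
proof -
  have "{0, 1} \<in> K_edges n" using assms by simp
  then show ?thesis unfolding colors_def by blast
qed

lemma z_color_values: "z_color n c s \<in> (\<lambda>i. real i / real n) ` {..n}"
proof -
  have "card {v \<in> {..<n}. \<exists>e \<in> K_edges n. v \<in> e \<and> c e = s} \<le> card {..<n}"
    by (rule card_mono) auto
  then show ?thesis by (auto simp: z_color_def)
qed

lemma z_coloring_in:
  assumes "n \<ge> 2" shows "z_coloring n c \<in> {z_color n c s |s. s \<in> colors n c}"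
  unfolding z_coloring_def
  using finite_colors[of n c] colors_nonempty[OF assms, of c] by (intro Max_in) auto

lemma finite_z_coloring_values:
  assumes "n \<ge> 2" shows "finite {z_coloring n c |c. card (colors n c) \<le> k}"
proof (rule finite_subset)
  show "{z_coloring n c |c. card (colors n c) \<le> k} \<subseteq> (\<lambda>i. real i / real n) ` {..n}"
  proof clarify
    fix c :: coloring
    obtain s where "z_coloring n c = z_color n c s" using z_coloring_in[OF assms, of c] by blast
    then show "z_coloring n c \<in> (\<lambda>i. real i / real n) ` {..n}"
      using z_color_values[of n c s] by simp
  qed
qed simp

lemma z_coloring_values_nonempty:
  assumes "k \<ge> 1" shows "{z_coloring n c |c. card (colors n c) \<le> k} \<noteq> {}"
proof -
  have "card (colors n (\<lambda>_. 0)) \<le> card {0::nat}"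
    by (rule card_mono) (auto simp: colors_def)
  then have "card (colors n (\<lambda>_. 0)) \<le> k" using assms by simp
  then show ?thesis by blast
qed

lemma bdd_below_z_min:
  assumes "k \<ge> 1" shows "bdd_below (z_min k ` {2..})"
proof (rule bdd_belowI2)
  fix n :: nat assume "n \<in> {2..}"
  then have n: "n \<ge> 2" by simp
  have "z_min k n \<in> {z_coloring n c |c. card (colors n c) \<le> k}"
    unfolding z_min_def
    by (rule Min_in[OF finite_z_coloring_values[OF n] z_coloring_values_nonempty[OF assms]])
  then obtain c where "z_min k n = z_coloring n c" by blast
  moreover obtain s where "z_coloring n c = z_color n c s" using z_coloring_in[OF n, of c] by blast
  ultimately show "0 \<le> z_min k n" by (simp add: z_color_def)
qed

end

theory Submission
  imports Defs
begin

text \<open>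
  Attach to every vertex the set of colors that it sees. The edge between two vertices has a color
  that both see, so these sets form an intersecting family of nonempty subsets of a palette with at
  most four colors.

  The bound then follows by linear programming duality: if nonnegative weights on the colors give
  every member of the family at least \<open>3/5\<close> of the total weight, then averaging with these weights
  shows that some color is seen by at least \<open>3/5\<close> of the vertices (\<open>popular_element\<close>). Such weights
  exist for every intersecting family on at most four points (\<open>intersecting_family_weights\<close>). What
  matters is how the two-element members meet: being pairwise intersecting, they have a common
  point or form a triangle (a one-element member is trivial, since its element lies in every
  member). Around a common point \<open>a\<close> the weights \<open>2, 1, 1, 1\<close> with \<open>2\<close> at \<open>a\<close> work, and this is
  the case that determines the constant \<open>3/5\<close>. On a triangle uniform weights give even \<open>2/3\<close>.
\<close>

text \<open>
  Both sides of the counting argument evaluate the total weight of the pairs of a member \<open>v\<close> of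
  \<open>V\<close> and an element of \<open>S v\<close>; if every element were rare, the total would be too small.
\<close>

lemma popular_element:
  fixes w :: "'a \<Rightarrow> nat" and S :: "'v \<Rightarrow> 'a set"
  assumes "finite V" "finite C"
    and pos: "(\<Sum>s\<in>C. w s) > 0"
    and heavy: "\<And>v. v \<in> V \<Longrightarrow> p * (\<Sum>s\<in>C. w s) \<le> q * (\<Sum>s\<in>C \<inter> S v. w s)"
  shows "\<exists>s\<in>C. p * card V \<le> q * card {v \<in> V. s \<in> S v}"
proof (rule ccontr)
  let ?d = "\<lambda>s. card {v \<in> V. s \<in> S v}"
  assume "\<not> ?thesis"
  then have rare: "q * ?d s < p * card V" if "s \<in> C" for s
    using that by (meson not_le)
  obtain t where t: "t \<in> C" "w t > 0"
    using pos by (metis gr0I sum.neutral less_irrefl)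
  have "(\<Sum>s\<in>C. w s * (q * ?d s)) < (\<Sum>s\<in>C. w s * (p * card V))"
  proof (rule sum_strict_mono_ex1[OF \<open>finite C\<close>])
    show "\<forall>s\<in>C. w s * (q * ?d s) \<le> w s * (p * card V)"
      using rare by (simp add: less_imp_le)
    show "\<exists>s\<in>C. w s * (q * ?d s) < w s * (p * card V)"
      using t rare[OF t(1)] by (intro bexI[of _ t]) simp_all
  qed
  also have "\<dots> = (\<Sum>v\<in>V. p * (\<Sum>s\<in>C. w s))"
    by (simp add: sum_distrib_left sum_distrib_right mult_ac)
  also have "\<dots> \<le> (\<Sum>v\<in>V. q * (\<Sum>s\<in>C \<inter> S v. w s))"
    by (intro sum_mono heavy)
  also have "\<dots> = (\<Sum>v\<in>V. \<Sum>s\<in>C. if s \<in> S v then q * w s else 0)"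
    by (auto simp: sum_distrib_left sum.inter_restrict[OF \<open>finite C\<close>] intro!: sum.cong)
  also have "\<dots> = (\<Sum>s\<in>C. \<Sum>v\<in>V. if s \<in> S v then q * w s else 0)"
    by (rule sum.swap)
  also have "\<dots> = (\<Sum>s\<in>C. w s * (q * ?d s))"
    by (simp add: sum.inter_filter[OF \<open>finite V\<close>, symmetric] mult_ac)
  finally show False by simp
qed

text \<open>
  A one-element member \<open>{a}\<close> forces \<open>a\<close> into all members, so all the weight can be put on \<open>a\<close>.
  Otherwise a member that misses the common point of the two-element members has at least three
  elements, and a member containing it has at least one more element; with the weights \<open>2, 1, 1, 1\<close>
  both have weight at least \<open>3\<close> out of at most \<open>5\<close>. If there is no common point, the pairs
  contain a triangle \<open>{a,b}, {b,c}, {a,c}\<close>, and a set that meets its three sides contains two of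
  its corners.
\<close>

lemma intersecting_family_weights:
  fixes F :: "'a set set"
  assumes "finite C" "card C \<le> 4" "C \<noteq> {}"
    and sub: "\<And>X. X \<in> F \<Longrightarrow> X \<subseteq> C"
    and nonempty: "\<And>X. X \<in> F \<Longrightarrow> X \<noteq> {}"
    and meet: "\<And>X Y. X \<in> F \<Longrightarrow> Y \<in> F \<Longrightarrow> X \<noteq> Y \<Longrightarrow> X \<inter> Y \<noteq> {}"
  shows "\<exists>w :: 'a \<Rightarrow> nat. (\<Sum>s\<in>C. w s) > 0 \<and>
           (\<forall>X\<in>F. 3 * (\<Sum>s\<in>C. w s) \<le> 5 * (\<Sum>s\<in>X. w s))"
proof -
  have fin: "finite X" if "X \<in> F" for X
    using sub[OF that] \<open>finite C\<close> by (rule finite_subset)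
  have indicator_sum: "(\<Sum>s\<in>X. if s \<in> T then 1 else 0) = card (X \<inter> T)" if "finite X" for X T :: "'a set"
    by (simp add: sum.inter_restrict[OF that, symmetric])
  consider (single) a where "{a} \<in> F"
    | (star) a where "a \<in> C" "\<And>X. X \<in> F \<Longrightarrow> card X \<noteq> 1" "\<And>X. X \<in> F \<Longrightarrow> card X = 2 \<Longrightarrow> a \<in> X"
    | (none) "\<And>a. a \<in> C \<Longrightarrow> \<exists>X\<in>F. card X = 2 \<and> a \<notin> X"
    by (metis card_1_singletonE)
  then show ?thesis
  proof cases
    case single
    have a: "a \<in> X" if "X \<in> F" for X
      using meet[OF that single] nonempty[OF that] by auto
    then have "C \<inter> {a} = {a}" "\<And>X. X \<in> F \<Longrightarrow> X \<inter> {a} = {a}"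
      using sub[OF single] by auto
    then show ?thesis
      using indicator_sum[OF \<open>finite C\<close>, of "{a}"] indicator_sum[OF fin, of _ "{a}"]
      by (intro exI[of _ "\<lambda>s. if s \<in> {a} then 1 else 0"]) simp
  next
    case star
    define w :: "'a \<Rightarrow> nat" where "w s = 1 + (if s \<in> {a} then 1 else 0)" for s
    have w: "sum w X = card X + card (X \<inter> {a})" if "finite X" for X
      unfolding w_def sum.distrib indicator_sum[OF that] by simp
    have "C \<inter> {a} = {a}" using star(1) by auto
    then have wC: "sum w C = card C + 1" by (simp add: w[OF \<open>finite C\<close>])
    have "3 \<le> sum w X" if X: "X \<in> F" for X
    proof -
      have "card X \<noteq> 0" using nonempty[OF X] fin[OF X] by simp
      then have ge2: "card X \<ge> 2" using star(2)[OF X] by linarith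
      show ?thesis
      proof (cases "a \<in> X")
        case True
        then have "X \<inter> {a} = {a}" by auto
        then show ?thesis using ge2 by (simp add: w[OF fin[OF X]])
      next
        case False
        then have "card X \<noteq> 2" using star(3)[OF X] by auto
        then show ?thesis using ge2 by (simp add: w[OF fin[OF X]])
      qed
    qed
    then have "3 * sum w C \<le> 5 * sum w X" if "X \<in> F" for X
      using wC \<open>card C \<le> 4\<close> that by fastforce
    then show ?thesis using wC by (intro exI[of _ w]) simp
  next
    case none
    obtain P where P: "P \<in> F" "card P = 2" using none \<open>C \<noteq> {}\<close> by blast
    then obtain a b where ab: "P = {a, b}" "a \<noteq> b" by (auto simp: card_2_iff)
    obtain Q where Q: "Q \<in> F" "card Q = 2" "a \<notin> Q"
      using none[of a] sub[OF P(1)] ab by auto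
    have "P \<inter> Q \<noteq> {}" using meet[OF P(1) Q(1)] Q(3) ab by auto
    then obtain c where Qc: "Q = {b, c}" "b \<noteq> c"
      using Q ab by (auto simp: card_2_iff)
    obtain R where R: "R \<in> F" "card R = 2" "b \<notin> R"
      using none[of b] sub[OF P(1)] ab by auto
    have "P \<inter> R \<noteq> {}" "Q \<inter> R \<noteq> {}"
      using meet[OF P(1) R(1)] meet[OF Q(1) R(1)] R(3) ab Qc by auto
    then have ac: "a \<in> R" "c \<in> R" using R(3) ab Qc by auto
    have "a \<noteq> c" using Q(3) Qc by auto
    then have Rac: "R = {a, c}"
      using R(2) ac by (auto simp: card_2_iff)
    let ?T = "{a, b, c}"
    have cardT: "card ?T = 3" using ab Qc \<open>a \<noteq> c\<close> by simp
    have CT: "C \<inter> ?T = ?T" using sub[OF P(1)] sub[OF Q(1)] ab Qc by auto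
    have two: "2 \<le> card (X \<inter> ?T)" if X: "X \<in> F" for X
    proof -
      have side: "X \<inter> Y \<noteq> {}" if "Y \<in> F" for Y
        using meet[OF X that] nonempty[OF X] by auto
      have "X \<inter> {a, b} \<noteq> {}" "X \<inter> {b, c} \<noteq> {}" "X \<inter> {a, c} \<noteq> {}"
        using side[OF P(1)] side[OF Q(1)] side[OF R(1)] ab Qc Rac by auto
      then have "P \<subseteq> X \<inter> ?T \<or> Q \<subseteq> X \<inter> ?T \<or> R \<subseteq> X \<inter> ?T"
        unfolding ab Qc Rac by blast
      then show ?thesis
        using card_mono[of "X \<inter> ?T"] P(2) Q(2) R(2) by (metis finite_Int finite.emptyI finite.insertI)
    qed
    have "3 * card (C \<inter> ?T) \<le> 5 * card (X \<inter> ?T)" if "X \<in> F" for X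
      using two[OF that] unfolding CT cardT by simp
    moreover have "card (C \<inter> ?T) > 0" unfolding CT cardT by simp
    ultimately show ?thesis
      using indicator_sum[OF \<open>finite C\<close>, of ?T] indicator_sum[OF fin, of _ ?T]
      by (intro exI[of _ "\<lambda>s. if s \<in> ?T then 1 else 0"]) simp
  qed
qed

lemma z_coloring_ge_three_fifths:
  assumes n: "n \<ge> 2" and four: "card (colors n c) \<le> 4"
  shows "z_coloring n c \<ge> 3 / 5"
proof -
  define S where "S v = {s. \<exists>e\<in>K_edges n. v \<in> e \<and> c e = s}" for v
  have sub: "S v \<subseteq> colors n c" for v
    by (auto simp: S_def colors_def)
  have edge: "c {u, v} \<in> S u \<inter> S v" if "u < n" "v < n" "u \<noteq> v" for u v
  proof -
    have "{u, v} \<in> K_edges n" using that by (simp add: nsets_def)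
    then show ?thesis unfolding S_def by blast
  qed
  have nonempty: "S v \<noteq> {}" if "v < n" for v
  proof -
    obtain u where "u < n" "u \<noteq> v"
      using n by (metis One_nat_def Suc_le_lessD less_le_trans nat_neq_iff numeral_2_eq_2 zero_less_Suc)
    then show ?thesis using edge[of u v] that by blast
  qed
  obtain w :: "nat \<Rightarrow> nat" where pos: "sum w (colors n c) > 0"
    and heavy: "\<And>X. X \<in> S ` {..<n} \<Longrightarrow> 3 * sum w (colors n c) \<le> 5 * sum w X"
  proof -
    have "\<exists>w :: nat \<Rightarrow> nat. sum w (colors n c) > 0 \<and>
           (\<forall>X\<in>S ` {..<n}. 3 * sum w (colors n c) \<le> 5 * sum w X)"
    proof (rule intersecting_family_weights[OF finite_colors four colors_nonempty[OF n]])
      fix X Y assume "X \<in> S ` {..<n}" "Y \<in> S ` {..<n}" "X \<noteq> Y"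
      then obtain u v where "X = S u" "Y = S v" "u < n" "v < n" "u \<noteq> v" by auto
      then show "X \<inter> Y \<noteq> {}" using edge[of u v] by blast
    qed (use sub nonempty in auto)
    then show thesis using that by blast
  qed
  have "\<exists>s\<in>colors n c. 3 * card {..<n} \<le> 5 * card {v \<in> {..<n}. s \<in> S v}"
  proof (rule popular_element[OF _ finite_colors pos])
    fix v assume "v \<in> {..<n}"
    then show "3 * sum w (colors n c) \<le> 5 * sum w (colors n c \<inter> S v)"
      using heavy[of "S v"] sub[of v] by (simp add: Int_absorb1)
  qed simp
  then obtain s where s: "s \<in> colors n c" "3 * n \<le> 5 * card {v \<in> {..<n}. s \<in> S v}"
    by auto
  from s(2) have "real (3 * n) \<le> real (5 * card {v \<in> {..<n}. s \<in> S v})"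
    by (rule of_nat_mono)
  then have "3 / 5 \<le> z_color n c s"
    using n by (simp add: z_color_def S_def field_simps)
  also have "\<dots> \<le> z_coloring n c"
    unfolding z_coloring_def using s(1) finite_colors[of n c] by (intro Max_ge) auto
  finally show ?thesis .
qed

theorem proposition2p7:
  shows "z_inf 4 \<ge> 3 / 5"
  unfolding z_inf_def
proof (rule cINF_greatest)
  fix n :: nat assume "n \<in> {2..}"
  then have n: "n \<ge> 2" by simp
  have "z_min 4 n \<in> {z_coloring n c |c. card (colors n c) \<le> 4}"
    unfolding z_min_def
    by (rule Min_in[OF finite_z_coloring_values[OF n] z_coloring_values_nonempty]) simp
  then show "3 / 5 \<le> z_min 4 n"
    using z_coloring_ge_three_fifths[OF n] by auto
qed simp

end
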